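(* There are an absolute constant $\gamma>0$ and an integer $k_0$ such that for every $n=2^k$ with $k\ge k_0$ and every integer $c\ge 1$, there is a finite collection of transmissions on the linear array with nodes $0,1,\dots,n$ whose congestion is exactly $c$ on every link, but for which every non-splittable schedule uses at least $\gamma\left(c+\frac{\log_2 n}{\log_2\log_2 n}\right)$ wavelengths. Explicitly, the following collection has this property: for each $i\in\{0,1,\dots,\log_2 n\}$ and each $j\in\{0,1,\dots,n/2^i-1\}$, one transmission $[j2^i,(j+1)2^i]$ of bandwidth $\frac{1}{\log_2 n+1}$, together with $c-1$ transmissions $[0,n]$ of bandwidth $1$.
   Context: Stationary light-trail scheduling problem. The network is a linear array of nodes $0,1,\dots,n$; link $l$ ($0\le l\le n-1$) joins nodes $l$ and $l+1$. A transmission $[i,j]$ with $0\le i<j\le n$ has a bandwidth requirement in $(0,1]$, expressed as a fraction of the capacity $1$ of a wavelength; it uses (crosses) the links $i,\dots,j-1$. On each wavelength, every node has a shutter which is ON or OFF; the shutters at the end nodes $0$ and $n$ are always OFF. A light-trail is a segment $[u,v]$ of a wavelength between two consecutive OFF shutters. A transmission $[i,j]$ can be assigned to a light-trail $[u,v]$ only if $u\le i<j\le v$, and the total bandwidth of the transmissions assigned to any single light-trail must be at most $1$. A non-splittable schedule using $w$ wavelengths is a choice of shutter settings on $w$ wavelengths and an assignment of every transmission to a single light-trail so that these constraints hold. The congestion of a collection of transmissions on link $l$ is the total bandwidth of the transmissions of the collection that cross link $l$. *)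

theory Defs
  imports Complex_Main
begin

record transmission =
  src :: nat
  dst :: nat
  bandwidth :: real

definition valid_transmission :: "nat \<Rightarrow> transmission \<Rightarrow> bool" where
  "valid_transmission n t \<longleftrightarrow>
     src t < dst t \<and> dst t \<le> n \<and> 0 < bandwidth t \<and> bandwidth t \<le> 1"

text \<open>
  A finite collection of transmissions is a list. Its members are addressed by position, so
  that equal transmissions remain distinct and may be assigned to different light-trails.
  Link \<open>l\<close> joins the nodes \<open>l\<close> and \<open>l + 1\<close>.
\<close>

definition crosses :: "transmission \<Rightarrow> nat \<Rightarrow> bool" where
  "crosses t l \<longleftrightarrow> src t \<le> l \<and> l < dst t"

definition congestion :: "transmission list \<Rightarrow> nat \<Rightarrow> real" where
  "congestion T l = (\<Sum>m | m < length T \<and> crosses (T ! m) l. bandwidth (T ! m))"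

text \<open>
  Wavelengths are numbered \<open>0, \<dots>, w - 1\<close>; \<open>off p\<close> is the set of nodes whose
  shutter is OFF on wavelength \<open>p\<close>.
\<close>

definition valid_shutters :: "nat \<Rightarrow> nat \<Rightarrow> (nat \<Rightarrow> nat set) \<Rightarrow> bool" where
  "valid_shutters n w off \<longleftrightarrow> (\<forall>p<w. {0, n} \<subseteq> off p \<and> off p \<subseteq> {0..n})"

record light_trail =
  wavelength :: nat
  left_end :: nat
  right_end :: nat

definition light_trails :: "nat \<Rightarrow> (nat \<Rightarrow> nat set) \<Rightarrow> light_trail set" where
  "light_trails w off =
     {L. wavelength L < w \<and> left_end L < right_end L \<and>
         left_end L \<in> off (wavelength L) \<and> right_end L \<in> off (wavelength L) \<and>
         (\<forall>x. left_end L < x \<and> x < right_end L \<longrightarrow> x \<notin> off (wavelength L))}"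

definition fits :: "transmission \<Rightarrow> light_trail \<Rightarrow> bool" where
  "fits t L \<longleftrightarrow> left_end L \<le> src t \<and> dst t \<le> right_end L"

definition nonsplittable_schedule ::
  "nat \<Rightarrow> transmission list \<Rightarrow> nat \<Rightarrow> (nat \<Rightarrow> nat set) \<Rightarrow> (nat \<Rightarrow> light_trail) \<Rightarrow> bool"
where
  "nonsplittable_schedule n T w off trail_of \<longleftrightarrow>
     valid_shutters n w off \<and>
     (\<forall>m<length T. trail_of m \<in> light_trails w off \<and> fits (T ! m) (trail_of m)) \<and>
     (\<forall>L\<in>light_trails w off.
        (\<Sum>m | m < length T \<and> trail_of m = L. bandwidth (T ! m)) \<le> 1)"

definition dyadic_transmissions :: "nat \<Rightarrow> nat \<Rightarrow> transmission list" where
  "dyadic_transmissions k c =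
     [\<lparr>src = j * 2 ^ i, dst = (j + 1) * 2 ^ i, bandwidth = 1 / (log 2 (2 ^ k) + 1)\<rparr>.
        i \<leftarrow> [0..<k + 1], j \<leftarrow> [0..<2 ^ k div 2 ^ i]] @
     replicate (c - 1) \<lparr>src = 0, dst = 2 ^ k, bandwidth = 1\<rparr>"

end

theory Submission
  imports Defs
begin

text \<open>
  Only the levels \<open>0, s, 2s, \<dots>\<close> matter, where \<open>2 ^ s \<ge> k + 2\<close>. Let a light-trail of length
  \<open>\<ell>\<close> carry \<open>N r\<close> transmissions of length \<open>2 ^ (s * r)\<close>. They are disjoint segments
  of the trail, so \<open>2 ^ (s * r) * N r \<le> \<ell>\<close>, and by capacity \<open>N r \<le> k + 1\<close>. If \<open>r = q\<close> is
  the highest level it carries, then the lower levels together cover at most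
  \<open>(k + 1) * (\<Sum>r<q. 2 ^ (s * r)) \<le> 2 ^ (s * q) \<le> \<ell>\<close>, so over all selected levels
  the trail serves a total length of at most \<open>2 * \<ell>\<close>. Summing over all trails, the selected levels,
  each of total length \<open>n\<close>, have total length at most \<open>2 * w * n\<close>. Hence \<open>w\<close> is at least
  half the number of selected levels, which is of order \<open>k / log 2 k\<close>; and
  \<open>w \<ge> c\<close> because of the congestion.
\<close>

subsection \<open>Light-trails\<close>

abbreviation trail_length :: "light_trail \<Rightarrow> nat" where
  "trail_length L \<equiv> right_end L - left_end L"

text \<open>Both trails contain link \<open>l\<close>, so an end of \<open>L'\<close> violating the
  claim would lie strictly inside \<open>L\<close>. But it is an OFF node, and \<open>L\<close> has
  none in its interior. Swapping the roles of \<open>L\<close> and \<open>L'\<close> then gives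
  uniqueness.\<close>

lemma light_trail_ends_le:
  assumes "L \<in> light_trails w off" "L' \<in> light_trails w off"
    and "wavelength L = wavelength L'"
    and "l \<in> {left_end L..<right_end L}" "l \<in> {left_end L'..<right_end L'}"
  shows "left_end L' \<le> left_end L" "right_end L \<le> right_end L'"
proof -
  have off: "left_end L' \<in> off (wavelength L)" "right_end L' \<in> off (wavelength L)"
    and gap: "\<And>x. left_end L < x \<Longrightarrow> x < right_end L \<Longrightarrow> x \<notin> off (wavelength L)"
    using assms(1-3) by (auto simp: light_trails_def)
  show "left_end L' \<le> left_end L"
    using gap[of "left_end L'"] off(1) assms(4,5) by fastforce
  show "right_end L \<le> right_end L'"
    using gap[of "right_end L'"] off(2) assms(4,5) by fastforce
qed

lemma light_trail_unique:
  assumes "L \<in> light_trails w off" "L' \<in> light_trails w off"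
    and "wavelength L = wavelength L'"
    and "l \<in> {left_end L..<right_end L}" "l \<in> {left_end L'..<right_end L'}"
  shows "L = L'"
  using light_trail_ends_le[OF assms] light_trail_ends_le[OF assms(2,1) assms(3)[symmetric] assms(5,4)]
    assms(3) by simp

lemma trail_ends:
  assumes "valid_shutters n w off" "L \<in> light_trails w off"
  shows "wavelength L < w" "left_end L < right_end L" "right_end L \<le> n"
  using assms unfolding valid_shutters_def light_trails_def by fastforce+

lemma finite_light_trails:
  assumes "valid_shutters n w off"
  shows "finite (light_trails w off)"
proof (rule finite_subset)
  show "light_trails w off \<subseteq>
      (\<lambda>(p, u, v). \<lparr>wavelength = p, left_end = u, right_end = v\<rparr>) ` ({..<w} \<times> {..n} \<times> {..n})"
  proof
    fix L assume L: "L \<in> light_trails w off"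
    show "L \<in> (\<lambda>(p, u, v). \<lparr>wavelength = p, left_end = u, right_end = v\<rparr>) `
        ({..<w} \<times> {..n} \<times> {..n})"
      using trail_ends[OF assms L]
      by (intro image_eqI[of _ _ "(wavelength L, left_end L, right_end L)"]) auto
  qed
qed simp

text \<open>Distinct trails occupy disjoint sets of pairs (wavelength, link), and there are only
  \<open>w * n\<close> such pairs.\<close>

lemma sum_trail_length_le:
  assumes "valid_shutters n w off"
  shows "(\<Sum>L\<in>light_trails w off. trail_length L) \<le> w * n"
proof -
  let ?links = "\<lambda>L. {wavelength L} \<times> {left_end L..<right_end L}"
  have "(\<Sum>L\<in>light_trails w off. trail_length L) = (\<Sum>L\<in>light_trails w off. card (?links L))"
    by simp
  also have "\<dots> = card (\<Union>L\<in>light_trails w off. ?links L)"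
    by (rule card_UN_disjoint[symmetric])
       (use finite_light_trails[OF assms] in \<open>auto dest: light_trail_unique\<close>)
  also have "\<dots> \<le> card ({..<w} \<times> {..<n})"
    by (rule card_mono) (use trail_ends[OF assms] in fastforce)+
  finally show ?thesis by simp
qed

text \<open>Every transmission crossing \<open>l\<close> sits on a trail containing
  \<open>l\<close>. Each wavelength has at most one such trail, and each trail carries bandwidth at
  most 1.\<close>

lemma congestion_le_wavelengths:
  assumes sched: "nonsplittable_schedule n T w off trail_of"
    and valid: "\<forall>t\<in>set T. valid_transmission n t"
  shows "congestion T l \<le> real w"
proof -
  let ?M = "{m. m < length T \<and> crosses (T ! m) l}"
  let ?C = "{L \<in> light_trails w off. l \<in> {left_end L..<right_end L}}"
  have vs: "valid_shutters n w off"
    using sched by (simp add: nonsplittable_schedule_def)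
  have trail: "trail_of m \<in> light_trails w off" "fits (T ! m) (trail_of m)" if "m < length T" for m
    using sched that by (auto simp: nonsplittable_schedule_def)
  have pos: "bandwidth (T ! m) \<ge> 0" if "m < length T" for m
    using valid nth_mem[OF that] by (auto simp: valid_transmission_def less_imp_le)
  have finC: "finite ?C"
    using finite_light_trails[OF vs] by simp
  have "trail_of ` ?M \<subseteq> ?C"
    using trail by (fastforce simp: fits_def crosses_def)
  then have "congestion T l = (\<Sum>L\<in>?C. \<Sum>m | m \<in> ?M \<and> trail_of m = L. bandwidth (T ! m))"
    unfolding congestion_def using finC by (intro sum.group[symmetric]) auto
  also have "\<dots> \<le> (\<Sum>L\<in>?C. 1)"
  proof (rule sum_mono)
    fix L assume "L \<in> ?C"
    have "(\<Sum>m | m \<in> ?M \<and> trail_of m = L. bandwidth (T ! m))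
        \<le> (\<Sum>m | m < length T \<and> trail_of m = L. bandwidth (T ! m))"
      by (rule sum_mono2) (use pos in auto)
    also have "\<dots> \<le> 1"
      using sched \<open>L \<in> ?C\<close> by (simp add: nonsplittable_schedule_def)
    finally show "(\<Sum>m | m \<in> ?M \<and> trail_of m = L. bandwidth (T ! m)) \<le> 1" .
  qed
  also have "\<dots> = real (card ?C)" by simp
  also have "card ?C \<le> card {..<w}"
    by (rule card_inj_on_le[where f = wavelength])
       (use trail_ends[OF vs] in \<open>auto intro!: inj_onI dest: light_trail_unique\<close>)
  finally show ?thesis by simp
qed

subsection \<open>The dyadic collection\<close>

abbreviation dyadic :: "nat \<Rightarrow> nat \<Rightarrow> nat \<Rightarrow> transmission" where
  "dyadic k i j \<equiv>
     \<lparr>src = j * 2 ^ i, dst = (j + 1) * 2 ^ i, bandwidth = 1 / (log 2 (2 ^ k) + 1)\<rparr>"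

lemma log2_power [simp]: "log 2 (2 ^ k) = real k"
  by (simp add: log_nat_power)

lemma dyadic_mem:
  assumes "i \<le> k" "j < 2 ^ (k - i)"
  shows "dyadic k i j \<in> set (dyadic_transmissions k c)"
proof -
  have "i \<in> set [0..<k + 1]" "j \<in> set [0..<2 ^ k div 2 ^ i]"
    using assms by (auto simp: power_diff)
  then show ?thesis
    unfolding dyadic_transmissions_def set_append set_concat set_map image_image
    by (intro UnI1 UN_I[of i] imageI)
qed

lemma dyadic_transmissions_valid:
  assumes "t \<in> set (dyadic_transmissions k c)"
  shows "valid_transmission (2 ^ k) t"
proof -
  have "(j + 1) * 2 ^ i \<le> 2 ^ k" if "i \<le> k" "j < 2 ^ k div 2 ^ i" for i j :: nat
  proof -
    have "(j + 1) * 2 ^ i \<le> (2 ^ k div 2 ^ i) * 2 ^ i"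
      using that by (intro mult_right_mono) auto
    also have "\<dots> \<le> 2 ^ k" by simp
    finally show ?thesis .
  qed
  then show ?thesis
    using assms by (auto simp: dyadic_transmissions_def valid_transmission_def)
qed

lemma congestion_eq_sum_list:
  "congestion T l = sum_list (map (\<lambda>t. if crosses t l then bandwidth t else 0) T)"
proof -
  have "congestion T l = (\<Sum>m\<in>{m \<in> {0..<length T}. crosses (T ! m) l}. bandwidth (T ! m))"
    unfolding congestion_def by (rule sum.cong) auto
  also have "\<dots> = (\<Sum>m\<in>{0..<length T}. if crosses (T ! m) l then bandwidth (T ! m) else 0)"
    by (rule sum.inter_filter) simp
  finally show ?thesis by (simp add: sum_list_sum_nth)
qed

lemma congestion_append: "congestion (S @ T) l = congestion S l + congestion T l"
  by (simp add: congestion_eq_sum_list)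

lemma congestion_concat: "congestion (concat Ts) l = (\<Sum>T\<leftarrow>Ts. congestion T l)"
  by (induction Ts) (auto simp: congestion_append congestion_eq_sum_list)

text \<open>The segments of one level tile the array, so exactly one of them, with index
  \<open>l div 2 ^ i\<close>, crosses \<open>l\<close>.\<close>

lemma congestion_dyadic_level:
  assumes "l < 2 ^ k" "i \<le> k"
  shows "congestion (map (dyadic k i) [0..<2 ^ k div 2 ^ i]) l = 1 / (real k + 1)"
proof -
  have crosses: "crosses (dyadic k i j) l \<longleftrightarrow> j = l div 2 ^ i" for j
    unfolding crosses_def by (auto simp: div_nat_eqI mult.commute dividend_less_times_div
      intro!: sym[OF div_nat_eqI])
  have "l div 2 ^ i < 2 ^ k div 2 ^ i"
    using assms by (simp add: less_mult_imp_div_less flip: power_add power_diff)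
  moreover have "congestion (map (dyadic k i) [0..<2 ^ k div 2 ^ i]) l
      = (\<Sum>j\<in>{0..<2 ^ k div 2 ^ i}. if j = l div 2 ^ i then 1 / (real k + 1) else 0)"
    unfolding congestion_eq_sum_list map_map comp_def crosses
    by (simp add: interv_sum_list_conv_sum_set_nat cong: if_cong)
  ultimately show ?thesis by simp
qed

lemma congestion_dyadic_transmissions:
  assumes "l < 2 ^ k" "c \<ge> 1"
  shows "congestion (dyadic_transmissions k c) l = real c"
proof -
  have "congestion (concat (map (\<lambda>i. map (dyadic k i) [0..<2 ^ k div 2 ^ i]) [0..<k + 1])) l
      = (\<Sum>i\<leftarrow>[0..<k + 1]. congestion (map (dyadic k i) [0..<2 ^ k div 2 ^ i]) l)"
    by (simp only: congestion_concat map_map comp_def)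
  also have "\<dots> = (\<Sum>i\<leftarrow>[0..<k + 1]. 1 / (real k + 1))"
    using congestion_dyadic_level[OF assms(1)]
    by (intro arg_cong[of _ _ sum_list] map_cong) auto
  also have "\<dots> = 1"
    by (simp add: sum_list_triv field_simps del: upt_Suc)
  finally have "congestion (concat (map (\<lambda>i. map (dyadic k i) [0..<2 ^ k div 2 ^ i]) [0..<k + 1])) l = 1" .
  \<comment> \<open>Here \<open>c \<ge> 1\<close> turns the truncated difference
    \<open>c - 1\<close> into a true one.\<close>
  moreover have "congestion (replicate (c - 1) \<lparr>src = 0, dst = 2 ^ k, bandwidth = 1\<rparr>) l = real c - 1"
    using assms by (simp add: congestion_eq_sum_list crosses_def sum_list_replicate of_nat_diff)
  ultimately show ?thesis
    unfolding dyadic_transmissions_def congestion_append by simp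
qed

subsection \<open>The lower bound\<close>

text \<open>Spacing the levels by \<open>s\<close> makes the powers grow so fast that
  \<open>K\<close> copies of all lower ones fit into one copy of the next: in the induction,
  \<open>K\<close> new terms and the old bound add up to \<open>K + 1\<close> copies of
  \<open>2 ^ (s * q)\<close>.\<close>

lemma sum_sparse_powers_le:
  fixes K s :: nat
  assumes "K + 1 \<le> 2 ^ s"
  shows "K * (\<Sum>r<q. 2 ^ (s * r)) \<le> 2 ^ (s * q)"
proof (induction q)
  case (Suc q)
  have "K * (\<Sum>r<Suc q. 2 ^ (s * r)) \<le> (K + 1) * 2 ^ (s * q)"
    using Suc by (simp add: algebra_simps)
  also have "\<dots> \<le> 2 ^ s * 2 ^ (s * q)"
    using assms by (rule mult_right_mono) simp
  finally show ?case by (simp add: power_add)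
qed simp

lemma sum_levels_le_twice_length:
  fixes N :: "nat \<Rightarrow> nat"
  assumes "K + 1 \<le> 2 ^ s"
    and "\<And>r. r < q \<Longrightarrow> N r \<le> K"
    and "\<And>r. r < q \<Longrightarrow> 2 ^ (s * r) * N r \<le> len"
  shows "(\<Sum>r<q. 2 ^ (s * r) * N r) \<le> 2 * len"
  using assms(2,3)
proof (induction q)
  case (Suc q)
  show ?case
  proof (cases "N q = 0")
    case True
    then show ?thesis using Suc by simp
  next
    \<comment> \<open>Now \<open>q\<close> is the highest level in use. It costs at most
      \<open>len\<close> itself, and the levels below cost at most \<open>2 ^ (s * q)\<close>, which
      is again at most \<open>len\<close>. The induction hypothesis serves only the case of an empty
      top level.\<close>
    case False
    have "(\<Sum>r<q. 2 ^ (s * r) * N r) \<le> (\<Sum>r<q. 2 ^ (s * r) * K)"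
      using Suc.prems(1) by (intro sum_mono mult_left_mono) auto
    also have "\<dots> = K * (\<Sum>r<q. 2 ^ (s * r))"
      by (simp add: sum_distrib_left mult.commute)
    also have "\<dots> \<le> 2 ^ (s * q)"
      by (rule sum_sparse_powers_le[OF assms(1)])
    also have "\<dots> \<le> 2 ^ (s * q) * N q"
      using False by simp
    finally show ?thesis
      using Suc.prems(2)[of q] by simp
  qed
qed simp

lemma card_dyadic_segments_le:
  assumes "finite J" and "\<And>j. j \<in> J \<Longrightarrow> u \<le> j * 2 ^ i \<and> (j + 1) * 2 ^ i \<le> (v::nat)"
  shows "2 ^ i * card J \<le> v - u"
proof -
  let ?seg = "\<lambda>j::nat. {j * 2 ^ i..<(j + 1) * 2 ^ i}"
  have seg: "x div 2 ^ i = j" if "x \<in> ?seg j" for x j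
    using that by (intro div_nat_eqI) (auto simp: mult.commute)
  have "2 ^ i * card J = (\<Sum>j\<in>J. card (?seg j))"
    by simp
  also have "\<dots> = card (\<Union>j\<in>J. ?seg j)"
    by (rule card_UN_disjoint[symmetric]) (use assms(1) seg in blast)+
  also have "\<dots> \<le> card {u..<v}"
    by (rule card_mono) (use assms(2) in fastforce)+
  finally show ?thesis by simp
qed

lemma levels_le_twice_wavelengths:
  assumes sched: "nonsplittable_schedule (2 ^ k) (dyadic_transmissions k c) w off trail_of"
    and s: "k + 2 \<le> 2 ^ s"
    and q: "\<And>r. r < q \<Longrightarrow> s * r \<le> k"
  shows "q \<le> 2 * w"
proof -
  define T where "T = dyadic_transmissions k c"
  let ?LT = "light_trails w off"
  have vs: "valid_shutters (2 ^ k) w off"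
    using sched by (simp add: nonsplittable_schedule_def)
  note fin = finite_light_trails[OF vs]
  have trail: "trail_of m \<in> ?LT" "fits (T ! m) (trail_of m)" if "m < length T" for m
    using sched that by (auto simp: nonsplittable_schedule_def T_def)
  have pos: "bandwidth (T ! m) \<ge> 0" if "m < length T" for m
    using dyadic_transmissions_valid[of "T ! m" k c] that
    by (simp add: T_def valid_transmission_def)
  \<comment> \<open>Assignments are made to positions in the list, so one position
    \<open>idx i j\<close> is fixed for each dyadic segment. \<open>J i L\<close> then collects the
    level-\<open>i\<close> segments carried by \<open>L\<close>.\<close>
  have "\<exists>m<length T. T ! m = dyadic k i j" if "i \<le> k" "j < 2 ^ (k - i)" for i j
    using dyadic_mem[OF that] by (simp add: in_set_conv_nth T_def)
  then obtain idx where idx: "idx i j < length T" "T ! idx i j = dyadic k i j"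
    if "i \<le> k" "j < 2 ^ (k - i)" for i j
    by metis
  define J where "J i L = {j. j < 2 ^ (k - i) \<and> trail_of (idx i j) = L}" for i L
  have finJ: "finite (J i L)" for i L
    by (simp add: J_def)
  \<comment> \<open>Non-splittability enters here: each segment is counted in exactly one
    trail.\<close>
  have total: "(\<Sum>L\<in>?LT. card (J i L)) = 2 ^ (k - i)" if "i \<le> k" for i
  proof -
    have "(\<Sum>L\<in>?LT. \<Sum>j | j \<in> {..<2 ^ (k - i)} \<and> trail_of (idx i j) = L. 1::nat)
        = (\<Sum>j\<in>{..<2 ^ (k - i) :: nat}. 1)"
      by (rule sum.group) (use fin trail idx that in auto)
    then show ?thesis by (simp add: J_def)
  qed
  have len: "2 ^ i * card (J i L) \<le> trail_length L" if "i \<le> k" for i L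
  proof (rule card_dyadic_segments_le[OF finJ])
    fix j assume "j \<in> J i L"
    then have j: "j < 2 ^ (k - i)" "trail_of (idx i j) = L"
      by (auto simp: J_def)
    show "left_end L \<le> j * 2 ^ i \<and> (j + 1) * 2 ^ i \<le> right_end L"
      using trail(2)[OF idx(1)[OF that j(1)]] j idx(2)[OF that j(1)] by (simp add: fits_def)
  qed
  have cap: "card (J i L) \<le> k + 1" if "i \<le> k" "L \<in> ?LT" for i L
  proof -
    \<comment> \<open>Distinct segments occupy distinct positions, so each uses its own share
      \<open>1 / (k + 1)\<close> of the capacity of \<open>L\<close>.\<close>
    have inj: "inj_on (idx i) (J i L)"
    proof (rule inj_onI)
      fix j j' assume "j \<in> J i L" "j' \<in> J i L" "idx i j = idx i j'"
      then have "dyadic k i j = dyadic k i j'"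
        using idx(2)[OF that(1)] by (metis (no_types, lifting) J_def mem_Collect_eq)
      then show "j = j'" by simp
    qed
    have "real (card (J i L)) / (real k + 1) = (\<Sum>j\<in>J i L. bandwidth (T ! idx i j))"
      using idx(2)[OF that(1)] by (simp add: J_def)
    also have "\<dots> = (\<Sum>m\<in>idx i ` J i L. bandwidth (T ! m))"
      using inj by (simp add: sum.reindex)
    also have "\<dots> \<le> (\<Sum>m | m < length T \<and> trail_of m = L. bandwidth (T ! m))"
      by (rule sum_mono2) (use pos idx(1)[OF that(1)] in \<open>auto simp: J_def\<close>)
    also have "\<dots> \<le> 1"
      using sched that(2) by (simp add: nonsplittable_schedule_def T_def)
    finally show ?thesis by (simp add: field_simps)
  qed
  \<comment> \<open>Double counting of the total length of the \<open>q\<close> selected levels: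
    first by level, then by trail.\<close>
  have "q * 2 ^ k = (\<Sum>r<q. 2 ^ (s * r) * 2 ^ (k - s * r))"
    using q by (simp flip: power_add)
  also have "\<dots> = (\<Sum>r<q. \<Sum>L\<in>?LT. 2 ^ (s * r) * card (J (s * r) L))"
    using total q by (simp flip: sum_distrib_left)
  also have "\<dots> = (\<Sum>L\<in>?LT. \<Sum>r<q. 2 ^ (s * r) * card (J (s * r) L))"
    by (rule sum.swap)
  also have "\<dots> \<le> (\<Sum>L\<in>?LT. 2 * trail_length L)"
    by (rule sum_mono, rule sum_levels_le_twice_length[where K = "k + 1"])
       (use s cap len q in auto)
  also have "\<dots> \<le> 2 * (w * 2 ^ k)"
    using sum_trail_length_le[OF vs] by (simp flip: sum_distrib_left)
  finally show ?thesis by simp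
qed

lemma wavelengths_ge_log_ratio:
  assumes sched: "nonsplittable_schedule (2 ^ k) (dyadic_transmissions k c) w off trail_of"
    and k: "k \<ge> 2"
  shows "real k / log 2 (real k) \<le> 6 * real w"
proof -
  \<comment> \<open>\<open>a\<close> is the integer part of \<open>log 2 k\<close>. Then
    \<open>2 ^ (a + 2) \<ge> 2 * (k + 1)\<close>, which leaves room for the required
    \<open>k + 2\<close>.\<close>
  obtain a where a: "2 ^ a \<le> k" "k < 2 ^ (a + 1)"
    using ex_power_ivl1[of 2 k] k by auto
  define s where "s = a + 2"
  have "k + 2 \<le> 2 ^ s"
    using a by (simp add: s_def)
  moreover have "s * r \<le> k" if "r < k div s + 1" for r
    using that by (metis less_Suc_eq_le Suc_eq_plus1 mult_le_mono2 times_div_less_eq_dividend le_trans)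
  ultimately have levels: "k div s + 1 \<le> 2 * w"
    using levels_le_twice_wavelengths[OF sched] by blast
  have "real a \<le> log 2 (real k)"
    using a k by (simp add: le_log_iff powr_realpow)
  moreover have log1: "1 \<le> log 2 (real k)"
    using k by (simp add: le_log_iff)
  \<comment> \<open>Both \<open>a\<close> and 1 are at most \<open>log 2 k\<close>, hence
    \<open>a + 2\<close> is at most three times it.\<close>
  ultimately have slog: "real s \<le> 3 * log 2 (real k)"
    by (simp add: s_def)
  have "k \<le> (k div s + 1) * s"
    using dividend_less_times_div[of s k] by (simp add: s_def algebra_simps)
  also have "\<dots> \<le> 2 * w * s"
    using levels by (rule mult_right_mono) simp
  finally have "real k \<le> real (2 * w * s)"
    by (simp only: of_nat_le_iff)
  also have "\<dots> \<le> 2 * real w * (3 * log 2 (real k))"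
    using mult_left_mono[OF slog, of "2 * real w"] by simp
  finally show ?thesis
    using log1 by (simp add: divide_simps)
qed

theorem mainTheorem2:
  shows "\<exists>\<gamma>::real. \<gamma> > 0 \<and> (\<exists>k0::nat. \<forall>k\<ge>k0. \<forall>n::nat. n = 2 ^ k \<longrightarrow> (\<forall>c::nat. c \<ge> 1 \<longrightarrow>
    (\<exists>T. T = dyadic_transmissions k c \<and>
      (\<forall>t\<in>set T. valid_transmission n t) \<and>
      (\<forall>l<n. congestion T l = real c) \<and>
      (\<forall>w off trail_of. nonsplittable_schedule n T w off trail_of \<longrightarrow>
         real w \<ge> \<gamma> * (real c + log 2 (real n) / log 2 (log 2 (real n)))))))"
proof -
  \<comment> \<open>The bounds \<open>c \<le> w\<close> and \<open>k / log 2 k \<le> 6 * w\<close>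
    sum to \<open>7 * w\<close>, so 1/12 is a safe constant. With \<open>k \<ge> 2\<close> the
    denominator is at least 1.\<close>
  have bound: "real w \<ge> 1 / 12 * (real c + log 2 (real (2 ^ k)) / log 2 (log 2 (real (2 ^ k))))"
    if k: "k \<ge> 2" and c: "c \<ge> 1"
      and sched: "nonsplittable_schedule (2 ^ k) (dyadic_transmissions k c) w off trail_of"
    for k c w off trail_of
  proof -
    have "real c \<le> real w"
      using congestion_le_wavelengths[OF sched, of 0] congestion_dyadic_transmissions[of 0 k c] c
        dyadic_transmissions_valid[of _ k c] by auto
    moreover have "log 2 (real (2 ^ k)) = real k"
      by simp
    ultimately show ?thesis
      using wavelengths_ge_log_ratio[OF sched k] by simp
  qed
  show ?thesis
  proof (rule exI[of _ "1 / 12"], rule conjI, simp, rule exI[of _ 2], intro allI impI)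
    fix k n c :: nat assume "2 \<le> k" "n = 2 ^ k" "1 \<le> c"
    then show "\<exists>T. T = dyadic_transmissions k c \<and>
      (\<forall>t\<in>set T. valid_transmission n t) \<and>
      (\<forall>l<n. congestion T l = real c) \<and>
      (\<forall>w off trail_of. nonsplittable_schedule n T w off trail_of \<longrightarrow>
         real w \<ge> 1 / 12 * (real c + log 2 (real n) / log 2 (log 2 (real n))))"
      using bound[of k c] dyadic_transmissions_valid congestion_dyadic_transmissions
      by (simp only: simp_thms ex_simps) blast
  qed
qed

end
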